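(* Let $\mathsf{JL}$ be a justification logic and $\mathcal{CS}$ a constant specification for $\mathsf{JL}$. If a formula $A$ is $\mathsf{JL}_{\mathcal{CS}}$-valid, then $A$ has a $\mathsf{JL}_{\mathcal{CS}}$-tableau proof.
   Context: Language. Justification terms are built from justification variables and constants using binary $\cdot,+$ and unary $!,\bar?,?$. Formulas: $A ::= p \mid \bot \mid \neg A \mid A\to A \mid t:A$, $p$ from a countable set $\mathcal P$ of propositional variables. Logics. $\mathsf J$ has axiom schemes: all propositional tautologies; $s:A\to(s+t):A$, $s:A\to(t+s):A$; $s:(A\to B)\to(t:A\to(s\cdot t):B)$. Further schemes: jT: $t:A\to A$; jD: $t:\bot\to\bot$; j4: $t:A\to\,!t:t:A$; jB: $\neg A\to\bar{?}t:\neg t:A$; j5: $\neg t:A\to ?t:\neg t:A$. A justification logic $\mathsf{JL}$ is $\mathsf J$ plus any combination of these; its language contains $\cdot,+$ and those of $!,\bar?,?$ occurring in its axioms; $Tm_{\mathsf{JL}},Fm_{\mathsf{JL}}$ are its terms and formulas. A constant specification $\mathcal{CS}$ for $\mathsf{JL}$ is a downward closed set of formulas $c_{i_n}:\dots:c_{i_1}:A$ ($n\ge1$, constants $c_{i_j}$, $A$ an axiom instance of $\mathsf{JL}$): if $c_{i_n}:c_{i_{n-1}}:\dots:c_{i_1}:A\in\mathcal{CS}$, $n\ge2$, then $c_{i_{n-1}}:\dots:c_{i_1}:A\in\mathcal{CS}$. Models. A $\mathsf{JL}_{\mathcal{CS}}$-model is $\mathcal M=(\mathcal E,\mathcal V)$,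 $\mathcal V:\mathcal P\to\{0,1\}$, $\mathcal E:Tm_{\mathsf{JL}}\to2^{Fm_{\mathsf{JL}}}$ with: (E1) $A\to B\in\mathcal E(s)$, $A\in\mathcal E(t)$ imply $B\in\mathcal E(s\cdot t)$; (E2) $\mathcal E(s)\cup\mathcal E(t)\subseteq\mathcal E(s+t)$; (E3) $c:F\in\mathcal{CS}$ implies $F\in\mathcal E(c)$; if jD: (E4) $\bot\notin\mathcal E(t)$; if j4: (E5) $A\in\mathcal E(t)\Rightarrow t:A\in\mathcal E(!t)$; if jB: (E6) $\mathcal M\not\Vdash A\Rightarrow\neg t:A\in\mathcal E(\bar?t)$; if j5: (E7) $A\notin\mathcal E(t)\Rightarrow\neg t:A\in\mathcal E(?t)$. Forcing: $\mathcal M\not\Vdash\bot$; $\mathcal M\Vdash p$ iff $\mathcal V(p)=1$; $\neg,\to$ classical; $\mathcal M\Vdash t:A$ iff $A\in\mathcal E(t)$ (without jT), resp. iff $A\in\mathcal E(t)$ and $\mathcal M\Vdash A$ (with jT). $F$ is $\mathsf{JL}_{\mathcal{CS}}$-valid if forced in every $\mathsf{JL}_{\mathcal{CS}}$-model. $\mathsf{JL}_{\mathcal{CS}}$-tableaux. A tableau for a finite set $S$ starts with a single branch of the formulas of $S$ (the root) and is extended by rule applications whose premises lie on the extended branch. Rules: $(F\neg)$: $\neg\neg A$ / $A$; $(F\to)$: $\neg(A\to B)$ / $A,\neg B$; $(T\to)$: $A\to B$ / $\neg A$ | $B$; $(F+)$: $\neg(t+s):A$ / $\neg t:A,\neg s:A$;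 $(F\cdot)$: $\neg(s\cdot t):B$ / $\neg s:(A\to B)$ | $\neg t:A$ for any formula $A$. Additionally: with jT, $(T:)$: $t:A$ / $A$; with jD, $(F:_\bot)$: add $\neg t:\bot$ for any term $t$; with j4, $(F!)$: $\neg!t:t:A$ / $\neg t:A$; with jB, $(F\bar?)$: $\neg\bar?t:\neg t:A$ / $A$; with j5, $(F?)$: $\neg?t:\neg t:A$ / $t:A$. A branch closes if it contains $A$ and $\neg A$, or $\bot$, or $\neg c:F$ with $c:F\in\mathcal{CS}$; a tableau is closed if all branches close. A $\mathsf{JL}_{\mathcal{CS}}$-tableau proof of $F$ is a closed $\mathsf{JL}_{\mathcal{CS}}$-tableau with root $\neg F$. *)

theory Defs
  imports Main "HOL-Library.Countable"
begin

datatype ('v, 'c) tm =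
    JVar 'v
  | JConst 'c
  | App "('v, 'c) tm" "('v, 'c) tm"   (infixl "\<^bold>\<cdot>" 80)
  | Sum "('v, 'c) tm" "('v, 'c) tm"   (infixl "\<^bold>+" 75)
  | Bang "('v, 'c) tm"                ("\<^bold>! _" [85] 85)
  | BarQuery "('v, 'c) tm"            ("\<^bold>?\<^sub>B _" [85] 85)
  | Query "('v, 'c) tm"               ("\<^bold>? _" [85] 85)

datatype ('v, 'c, 'p) fm =
    Atom 'p
  | Falsum                                      ("\<^bold>\<bottom>")
  | Neg "('v, 'c, 'p) fm"                       ("\<^bold>\<not> _" [70] 70)
  | Imp "('v, 'c, 'p) fm" "('v, 'c, 'p) fm"     (infixr "\<^bold>\<rightarrow>" 60)
  | Just "('v, 'c) tm" "('v, 'c, 'p) fm"        (infixr "\<^bold>:" 72)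

text \<open>
  A justification logic is identified with the set of schemes it adds to the basic logic
  \<open>J\<close>.  All notions below are relative to the language of that logic, carved out of the
  full datatypes by \<open>Tm\<close> and \<open>Fm\<close>.  The operator written with a barred question mark
  in the literature is \<open>\<^bold>?\<^sub>B\<close> here.
\<close>

datatype scheme = jT | jD | j4 | jB | j5

type_synonym logic = "scheme set"

inductive_set Tm :: "logic \<Rightarrow> ('v, 'c) tm set" for L :: logic where
  "JVar x \<in> Tm L"
| "JConst c \<in> Tm L"
| "\<lbrakk>s \<in> Tm L; t \<in> Tm L\<rbrakk> \<Longrightarrow> s \<^bold>\<cdot> t \<in> Tm L"
| "\<lbrakk>s \<in> Tm L; t \<in> Tm L\<rbrakk> \<Longrightarrow> s \<^bold>+ t \<in> Tm L"
| "\<lbrakk>j4 \<in> L; t \<in> Tm L\<rbrakk> \<Longrightarrow> \<^bold>! t \<in> Tm L"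
| "\<lbrakk>jB \<in> L; t \<in> Tm L\<rbrakk> \<Longrightarrow> \<^bold>?\<^sub>B t \<in> Tm L"
| "\<lbrakk>j5 \<in> L; t \<in> Tm L\<rbrakk> \<Longrightarrow> \<^bold>? t \<in> Tm L"

inductive_set Fm :: "logic \<Rightarrow> ('v, 'c, 'p) fm set" for L :: logic where
  "Atom p \<in> Fm L"
| "\<^bold>\<bottom> \<in> Fm L"
| "A \<in> Fm L \<Longrightarrow> \<^bold>\<not> A \<in> Fm L"
| "\<lbrakk>A \<in> Fm L; B \<in> Fm L\<rbrakk> \<Longrightarrow> A \<^bold>\<rightarrow> B \<in> Fm L"
| "\<lbrakk>t \<in> Tm L; A \<in> Fm L\<rbrakk> \<Longrightarrow> t \<^bold>: A \<in> Fm L"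

text \<open>
  Propositional tautologies in the justification language: formulas \<open>t \<^bold>: A\<close> are treated
  as additional atoms, so that these are exactly the substitution instances of tautologies.
\<close>

primrec prop_eval ::
  "('p \<Rightarrow> bool) \<Rightarrow> (('v, 'c) tm \<Rightarrow> ('v, 'c, 'p) fm \<Rightarrow> bool) \<Rightarrow> ('v, 'c, 'p) fm \<Rightarrow> bool" where
  "prop_eval v w (Atom p) = v p"
| "prop_eval v w \<^bold>\<bottom> = False"
| "prop_eval v w (\<^bold>\<not> A) = (\<not> prop_eval v w A)"
| "prop_eval v w (A \<^bold>\<rightarrow> B) = (prop_eval v w A \<longrightarrow> prop_eval v w B)"
| "prop_eval v w (t \<^bold>: A) = w t A"

definition tautology :: "('v, 'c, 'p) fm \<Rightarrow> bool" where
  "tautology A \<longleftrightarrow> (\<forall>v w. prop_eval v w A)"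

inductive axiom_scheme :: "logic \<Rightarrow> ('v, 'c, 'p) fm \<Rightarrow> bool" for L :: logic where
  "tautology A \<Longrightarrow> axiom_scheme L A"
| "axiom_scheme L (s \<^bold>: A \<^bold>\<rightarrow> (s \<^bold>+ t) \<^bold>: A)"
| "axiom_scheme L (s \<^bold>: A \<^bold>\<rightarrow> (t \<^bold>+ s) \<^bold>: A)"
| "axiom_scheme L (s \<^bold>: (A \<^bold>\<rightarrow> B) \<^bold>\<rightarrow> (t \<^bold>: A \<^bold>\<rightarrow> (s \<^bold>\<cdot> t) \<^bold>: B))"
| "jT \<in> L \<Longrightarrow> axiom_scheme L (t \<^bold>: A \<^bold>\<rightarrow> A)"
| "jD \<in> L \<Longrightarrow> axiom_scheme L (t \<^bold>: \<^bold>\<bottom> \<^bold>\<rightarrow> \<^bold>\<bottom>)"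
| "j4 \<in> L \<Longrightarrow> axiom_scheme L (t \<^bold>: A \<^bold>\<rightarrow> \<^bold>! t \<^bold>: t \<^bold>: A)"
| "jB \<in> L \<Longrightarrow> axiom_scheme L (\<^bold>\<not> A \<^bold>\<rightarrow> \<^bold>?\<^sub>B t \<^bold>: (\<^bold>\<not> t \<^bold>: A))"
| "j5 \<in> L \<Longrightarrow> axiom_scheme L (\<^bold>\<not> t \<^bold>: A \<^bold>\<rightarrow> \<^bold>? t \<^bold>: (\<^bold>\<not> t \<^bold>: A))"

definition axiom_instance :: "logic \<Rightarrow> ('v, 'c, 'p) fm \<Rightarrow> bool" where
  "axiom_instance L A \<longleftrightarrow> A \<in> Fm L \<and> axiom_scheme L A"

text \<open>The list \<open>[c\<^sub>n, \<dots>, c\<^sub>1]\<close> gives \<open>c\<^sub>n : \<dots> : c\<^sub>1 : A\<close>.\<close>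

definition const_chain :: "'c list \<Rightarrow> ('v, 'c, 'p) fm \<Rightarrow> ('v, 'c, 'p) fm" where
  "const_chain cs A = foldr (\<lambda>c F. JConst c \<^bold>: F) cs A"

definition constant_specification :: "logic \<Rightarrow> ('v, 'c, 'p) fm set \<Rightarrow> bool" where
  "constant_specification L CS \<longleftrightarrow>
     (\<forall>F \<in> CS. \<exists>cs A. cs \<noteq> [] \<and> axiom_instance L A \<and> F = const_chain cs A) \<and>
     (\<forall>c cs A. cs \<noteq> [] \<and> axiom_instance L A \<and> const_chain (c # cs) A \<in> CS
        \<longrightarrow> const_chain cs A \<in> CS)"

primrec forces ::
  "logic \<Rightarrow> (('v, 'c) tm \<Rightarrow> ('v, 'c, 'p) fm set) \<Rightarrow> ('p \<Rightarrow> bool) \<Rightarrow> ('v, 'c, 'p) fm \<Rightarrow> bool" where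
  "forces L E V (Atom p) = V p"
| "forces L E V \<^bold>\<bottom> = False"
| "forces L E V (\<^bold>\<not> A) = (\<not> forces L E V A)"
| "forces L E V (A \<^bold>\<rightarrow> B) = (forces L E V A \<longrightarrow> forces L E V B)"
| "forces L E V (t \<^bold>: A) = (A \<in> E t \<and> (jT \<in> L \<longrightarrow> forces L E V A))"

text \<open>
  The evidence function is a function from \<open>Tm L\<close> to sets of formulas in \<open>Fm L\<close>; its values
  outside \<open>Tm L\<close> are arbitrary and do not affect forcing of formulas in \<open>Fm L\<close>.
\<close>

definition model ::
  "logic \<Rightarrow> ('v, 'c, 'p) fm set \<Rightarrow> (('v, 'c) tm \<Rightarrow> ('v, 'c, 'p) fm set) \<Rightarrow> ('p \<Rightarrow> bool) \<Rightarrow> bool" where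
  "model L CS E V \<longleftrightarrow>
     (\<forall>t \<in> Tm L. E t \<subseteq> Fm L) \<and>
     (\<forall>s \<in> Tm L. \<forall>t \<in> Tm L. \<forall>A B. (A \<^bold>\<rightarrow> B) \<in> E s \<and> A \<in> E t \<longrightarrow> B \<in> E (s \<^bold>\<cdot> t)) \<and>
     (\<forall>s \<in> Tm L. \<forall>t \<in> Tm L. E s \<union> E t \<subseteq> E (s \<^bold>+ t)) \<and>
     (\<forall>c F. JConst c \<^bold>: F \<in> CS \<longrightarrow> F \<in> E (JConst c)) \<and>
     (jD \<in> L \<longrightarrow> (\<forall>t \<in> Tm L. \<^bold>\<bottom> \<notin> E t)) \<and>
     (j4 \<in> L \<longrightarrow> (\<forall>t \<in> Tm L. \<forall>A. A \<in> E t \<longrightarrow> t \<^bold>: A \<in> E (\<^bold>! t))) \<and>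
     (jB \<in> L \<longrightarrow> (\<forall>t \<in> Tm L. \<forall>A \<in> Fm L. \<not> forces L E V A \<longrightarrow> (\<^bold>\<not> t \<^bold>: A) \<in> E (\<^bold>?\<^sub>B t))) \<and>
     (j5 \<in> L \<longrightarrow> (\<forall>t \<in> Tm L. \<forall>A \<in> Fm L. A \<notin> E t \<longrightarrow> (\<^bold>\<not> t \<^bold>: A) \<in> E (\<^bold>? t)))"

definition valid :: "logic \<Rightarrow> ('v, 'c, 'p) fm set \<Rightarrow> ('v, 'c, 'p) fm \<Rightarrow> bool" where
  "valid L CS F \<longleftrightarrow> (\<forall>E V. model L CS E V \<longrightarrow> forces L E V F)"

text \<open>
  \<open>tableau_rule L \<B> \<C>\<close>: some rule is applicable to a branch with set of formulas \<open>\<B>\<close> and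
  splits it into one new branch for each element of \<open>\<C>\<close>, whose formulas are the ones added.
\<close>

inductive tableau_rule ::
  "logic \<Rightarrow> ('v, 'c, 'p) fm set \<Rightarrow> ('v, 'c, 'p) fm set list \<Rightarrow> bool"
  for L :: logic and \<B> :: "('v, 'c, 'p) fm set" where
  F_neg: "(\<^bold>\<not> \<^bold>\<not> A) \<in> \<B> \<Longrightarrow> tableau_rule L \<B> [{A}]"
| F_imp: "(\<^bold>\<not> (A \<^bold>\<rightarrow> B)) \<in> \<B> \<Longrightarrow> tableau_rule L \<B> [{A, \<^bold>\<not> B}]"
| T_imp: "(A \<^bold>\<rightarrow> B) \<in> \<B> \<Longrightarrow> tableau_rule L \<B> [{\<^bold>\<not> A}, {B}]"
| F_sum: "(\<^bold>\<not> (t \<^bold>+ s) \<^bold>: A) \<in> \<B> \<Longrightarrow> tableau_rule L \<B> [{\<^bold>\<not> t \<^bold>: A, \<^bold>\<not> s \<^bold>: A}]"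
| F_app: "\<lbrakk>(\<^bold>\<not> (s \<^bold>\<cdot> t) \<^bold>: B) \<in> \<B>; A \<in> Fm L\<rbrakk>
    \<Longrightarrow> tableau_rule L \<B> [{\<^bold>\<not> s \<^bold>: (A \<^bold>\<rightarrow> B)}, {\<^bold>\<not> t \<^bold>: A}]"
| T_just: "\<lbrakk>jT \<in> L; (t \<^bold>: A) \<in> \<B>\<rbrakk> \<Longrightarrow> tableau_rule L \<B> [{A}]"
| F_just_bot: "\<lbrakk>jD \<in> L; t \<in> Tm L\<rbrakk> \<Longrightarrow> tableau_rule L \<B> [{\<^bold>\<not> t \<^bold>: \<^bold>\<bottom>}]"
| F_bang: "\<lbrakk>j4 \<in> L; (\<^bold>\<not> \<^bold>! t \<^bold>: t \<^bold>: A) \<in> \<B>\<rbrakk> \<Longrightarrow> tableau_rule L \<B> [{\<^bold>\<not> t \<^bold>: A}]"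
| F_barquery: "\<lbrakk>jB \<in> L; (\<^bold>\<not> \<^bold>?\<^sub>B t \<^bold>: (\<^bold>\<not> t \<^bold>: A)) \<in> \<B>\<rbrakk> \<Longrightarrow> tableau_rule L \<B> [{A}]"
| F_query: "\<lbrakk>j5 \<in> L; (\<^bold>\<not> \<^bold>? t \<^bold>: (\<^bold>\<not> t \<^bold>: A)) \<in> \<B>\<rbrakk> \<Longrightarrow> tableau_rule L \<B> [{t \<^bold>: A}]"

text \<open>A tableau is given by the list of its branches, each recorded as its set of formulas.\<close>

inductive tableau ::
  "logic \<Rightarrow> ('v, 'c, 'p) fm set \<Rightarrow> ('v, 'c, 'p) fm set list \<Rightarrow> bool"
  for L :: logic and S :: "('v, 'c, 'p) fm set" where
  root: "\<lbrakk>finite S; S \<subseteq> Fm L\<rbrakk> \<Longrightarrow> tableau L S [S]"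
| extend: "\<lbrakk>tableau L S (\<T>\<^sub>1 @ \<B> # \<T>\<^sub>2); tableau_rule L \<B> \<C>\<rbrakk>
    \<Longrightarrow> tableau L S (\<T>\<^sub>1 @ map (\<lambda>C. \<B> \<union> C) \<C> @ \<T>\<^sub>2)"

definition closed_branch :: "('v, 'c, 'p) fm set \<Rightarrow> ('v, 'c, 'p) fm set \<Rightarrow> bool" where
  "closed_branch CS \<B> \<longleftrightarrow>
     (\<exists>A. A \<in> \<B> \<and> (\<^bold>\<not> A) \<in> \<B>) \<or>
     \<^bold>\<bottom> \<in> \<B> \<or>
     (\<exists>c F. (\<^bold>\<not> JConst c \<^bold>: F) \<in> \<B> \<and> (JConst c \<^bold>: F) \<in> CS)"

definition closed_tableau :: "('v, 'c, 'p) fm set \<Rightarrow> ('v, 'c, 'p) fm set list \<Rightarrow> bool" where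
  "closed_tableau CS \<T> \<longleftrightarrow> (\<forall>\<B> \<in> set \<T>. closed_branch CS \<B>)"

definition tableau_proof ::
  "logic \<Rightarrow> ('v, 'c, 'p) fm set \<Rightarrow> ('v, 'c, 'p) fm \<Rightarrow> ('v, 'c, 'p) fm set list \<Rightarrow> bool" where
  "tableau_proof L CS F \<T> \<longleftrightarrow> tableau L {\<^bold>\<not> F} \<T> \<and> closed_tableau CS \<T>"

end

theory Submission
  imports Defs
begin

text \<open>
  A set of formulas none of whose tableaux closes extends, by Zorn's lemma, to a maximal set
  \<open>M\<close> of this kind, which is then closed under the tableau rules.  Lacking a cut rule, \<open>M\<close>
  need not decide every formula, so the evidence function is read off from the negative
  formulas: \<open>A\<close> is evidenced by \<open>t\<close> unless \<open>\<^bold>\<not> t \<^bold>: A\<close> lies in \<open>M\<close>.  Each model condition then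
  is the contrapositive of one tableau rule, and \<open>M\<close> is satisfied in the resulting model.
\<close>

text \<open>Closing a single branch, presented as a derivation tree. The branch may be infinite,
  whereas \<open>tableau\<close> demands a finite root; this is what lets Zorn's lemma be applied to
  sets that are not refutable.\<close>

inductive refutable :: "logic \<Rightarrow> ('v, 'c, 'p) fm set \<Rightarrow> ('v, 'c, 'p) fm set \<Rightarrow> bool"
  for L CS where
  closed: "closed_branch CS \<B> \<Longrightarrow> refutable L CS \<B>"
| rule: "\<lbrakk>tableau_rule L \<B> \<C>; \<And>C. C \<in> set \<C> \<Longrightarrow> refutable L CS (\<B> \<union> C)\<rbrakk>
    \<Longrightarrow> refutable L CS \<B>"

section \<open>Refutability: monotonicity, compactness and closed tableaux\<close>

lemma tableau_rule_mono:
  assumes "tableau_rule L \<B> \<C>" "\<B> \<subseteq> \<B>'"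
  shows "tableau_rule L \<B>' \<C>"
  using assms by cases (blast intro: tableau_rule.intros)+

text \<open>Each rule inspects at most one formula of the branch. The case of the empty set is
  \<open>F_just_bot\<close>, which has no premise.\<close>

lemma tableau_rule_compact:
  assumes "tableau_rule L \<B> \<C>"
  shows "\<exists>F. finite F \<and> F \<subseteq> \<B> \<and> tableau_rule L F \<C>"
proof -
  have "tableau_rule L {} \<C> \<or> (\<exists>P \<in> \<B>. tableau_rule L {P} \<C>)"
    using assms by cases (blast intro: tableau_rule.intros)+
  then show ?thesis
  proof (elim disjE bexE)
    fix P assume "P \<in> \<B>" "tableau_rule L {P} \<C>"
    then show ?thesis by (intro exI[of _ "{P}"]) auto
  qed blast
qed

lemma closed_branch_mono:
  "closed_branch CS \<B> \<Longrightarrow> \<B> \<subseteq> \<B>' \<Longrightarrow> closed_branch CS \<B>'"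
  unfolding closed_branch_def by blast

lemma closed_branch_compact:
  assumes "closed_branch CS \<B>"
  shows "\<exists>F. finite F \<and> F \<subseteq> \<B> \<and> closed_branch CS F"
proof -
  from assms consider A where "A \<in> \<B>" "(\<^bold>\<not> A) \<in> \<B>" | "\<^bold>\<bottom> \<in> \<B>"
    | c F where "(\<^bold>\<not> JConst c \<^bold>: F) \<in> \<B>" "(JConst c \<^bold>: F) \<in> CS"
    unfolding closed_branch_def by blast
  then show ?thesis
  proof cases
    case (1 A)
    then show ?thesis by (intro exI[of _ "{A, \<^bold>\<not> A}"]) (auto simp: closed_branch_def)
  next
    case 2
    then show ?thesis by (intro exI[of _ "{\<^bold>\<bottom>}"]) (auto simp: closed_branch_def)
  next
    case (3 c F)
    then show ?thesis
      by (intro exI[of _ "{\<^bold>\<not> JConst c \<^bold>: F}"]) (auto simp: closed_branch_def)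
  qed
qed

lemma refutable_mono:
  assumes "refutable L CS \<B>" "\<B> \<subseteq> \<B>'"
  shows "refutable L CS \<B>'"
  using assms
proof (induction arbitrary: \<B>')
  case (closed \<B>)
  then show ?case using closed_branch_mono refutable.closed by blast
next
  case (rule \<B> \<C>)
  show ?case
  proof (rule refutable.rule)
    show "tableau_rule L \<B>' \<C>" using rule.hyps rule.prems by (blast intro: tableau_rule_mono)
    show "refutable L CS (\<B>' \<union> C)" if "C \<in> set \<C>" for C
      using that rule.prems by (intro rule.IH) auto
  qed
qed

lemma refutable_compact:
  assumes "refutable L CS \<B>"
  shows "\<exists>F. finite F \<and> F \<subseteq> \<B> \<and> refutable L CS F"
  using assms
proof induction
  case (closed \<B>)
  from closed_branch_compact[OF this] show ?case by (blast intro: refutable.closed)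
next
  case (rule \<B> \<C>)
  from rule.IH have "\<forall>C \<in> set \<C>. \<exists>F. finite F \<and> F \<subseteq> \<B> \<union> C \<and> refutable L CS F"
    by blast
  from bchoice[OF this] obtain f where
    f: "\<And>C. C \<in> set \<C> \<Longrightarrow> finite (f C) \<and> f C \<subseteq> \<B> \<union> C \<and> refutable L CS (f C)"
    by blast
  obtain F where F: "finite F" "F \<subseteq> \<B>" "tableau_rule L F \<C>"
    using tableau_rule_compact[OF rule.hyps(1)] by blast
  \<comment> \<open>\<open>f C\<close> may use formulas of \<open>C\<close> as well as of \<B>. Only
    its part in \<B> is kept, since the rule adds \<open>C\<close> back on the branch
    concerned.\<close>
  define G where "G = F \<union> (\<Union>C \<in> set \<C>. f C \<inter> \<B>)"
  have "refutable L CS G"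
  proof (rule refutable.rule)
    show "tableau_rule L G \<C>" using F(3) by (rule tableau_rule_mono) (auto simp: G_def)
    show "refutable L CS (G \<union> C)" if "C \<in> set \<C>" for C
    proof (rule refutable_mono)
      show "refutable L CS (f C)" using f that by blast
      show "f C \<subseteq> G \<union> C" using f[OF that] that by (auto simp: G_def)
    qed
  qed
  moreover have "finite G" unfolding G_def using F(1) f by simp
  moreover have "G \<subseteq> \<B>" using F(2) by (auto simp: G_def)
  ultimately show ?case by blast
qed

text \<open>The derivation tree is replayed at one position of the branch list. The neighbours are
  arbitrary because the branches split off by a rule become neighbours of each other.\<close>

lemma refutable_closes_branch:
  assumes "refutable L CS \<B>" "tableau L S (\<T>\<^sub>1 @ \<B> # \<T>\<^sub>2)"
  shows "\<exists>\<T>. closed_tableau CS \<T> \<and> tableau L S (\<T>\<^sub>1 @ \<T> @ \<T>\<^sub>2)"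
  using assms
proof (induction arbitrary: \<T>\<^sub>1 \<T>\<^sub>2)
  case (closed \<B>)
  then show ?case by (intro exI[of _ "[\<B>]"]) (auto simp: closed_tableau_def)
next
  case (rule \<B> \<C>)
  \<comment> \<open>The branches created by the rule are closed from left to right: \<D> lists those
    still to be treated, and the closed branches already obtained are absorbed into
    \<open>\<T>\<^sub>1\<close>.\<close>
  have "\<exists>\<T>. closed_tableau CS \<T> \<and> tableau L S (\<T>\<^sub>1 @ \<T> @ \<T>\<^sub>2)"
    if "set \<D> \<subseteq> set \<C>" "tableau L S (\<T>\<^sub>1 @ map (\<lambda>C. \<B> \<union> C) \<D> @ \<T>\<^sub>2)" for \<D> \<T>\<^sub>1
    using that
  proof (induction \<D> arbitrary: \<T>\<^sub>1)
    case Nil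
    then show ?case by (intro exI[of _ "[]"]) (auto simp: closed_tableau_def)
  next
    case (Cons C \<D>)
    obtain \<T> where \<T>: "closed_tableau CS \<T>"
        "tableau L S (\<T>\<^sub>1 @ \<T> @ map (\<lambda>C. \<B> \<union> C) \<D> @ \<T>\<^sub>2)"
      using rule.IH[of C \<T>\<^sub>1 "map (\<lambda>C. \<B> \<union> C) \<D> @ \<T>\<^sub>2"] Cons.prems by auto
    obtain \<T>' where "closed_tableau CS \<T>'" "tableau L S ((\<T>\<^sub>1 @ \<T>) @ \<T>' @ \<T>\<^sub>2)"
      using Cons.IH[of "\<T>\<^sub>1 @ \<T>"] Cons.prems \<T> by auto
    with \<T>(1) show ?case by (intro exI[of _ "\<T> @ \<T>'"]) (auto simp: closed_tableau_def)
  qed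
  from this[OF subset_refl tableau.extend[OF rule.prems rule.hyps(1)]] show ?case .
qed

lemma tableau_proof_if_refutable:
  assumes "refutable L CS {\<^bold>\<not> A}" "A \<in> Fm L"
  shows "\<exists>\<T>. tableau_proof L CS A \<T>"
proof -
  have "tableau L {\<^bold>\<not> A} ([] @ {\<^bold>\<not> A} # [])"
    using assms(2) by (auto intro: tableau.root Fm.intros)
  from refutable_closes_branch[OF assms(1) this] show ?thesis
    by (auto simp: tableau_proof_def)
qed

section \<open>Saturated open sets, the Hintikka sets of this calculus\<close>

definition saturated :: "logic \<Rightarrow> ('v, 'c, 'p) fm set \<Rightarrow> bool" where
  "saturated L M \<longleftrightarrow> (\<forall>\<C>. tableau_rule L M \<C> \<longrightarrow> (\<exists>C \<in> set \<C>. C \<subseteq> M))"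

lemma saturated_extension:
  assumes "\<not> refutable L CS S"
  obtains M where "S \<subseteq> M" "\<not> closed_branch CS M" "saturated L M"
proof -
  let ?A = "{M. S \<subseteq> M \<and> \<not> refutable L CS M}"
  have "\<Union>\<K> \<in> ?A" if nonempty: "\<K> \<noteq> {}" and chain: "subset.chain ?A \<K>" for \<K>
  proof -
    have "\<not> refutable L CS (\<Union>\<K>)"
    proof
      assume "refutable L CS (\<Union>\<K>)"
      then obtain F where F: "finite F" "F \<subseteq> \<Union>\<K>" "refutable L CS F"
        using refutable_compact[of L CS "\<Union>\<K>"] by blast
      \<comment> \<open>Compactness pays off here: the finite refutable part of the union already
        lies in one member of the chain.\<close>
      from finite_subset_Union_chain[OF F(1,2) nonempty chain] obtain K where "K \<in> \<K>" "F \<subseteq> K" .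
      with F(3) have "refutable L CS K" by (blast intro: refutable_mono)
      with \<open>K \<in> \<K>\<close> chain show False by (auto simp: subset.chain_def)
    qed
    moreover obtain K where "K \<in> \<K>" using nonempty by blast
    with chain have "S \<subseteq> \<Union>\<K>" by (auto simp: subset.chain_def)
    ultimately show ?thesis by blast
  qed
  moreover have "?A \<noteq> {}" using assms by blast
  ultimately have "\<exists>M \<in> ?A. \<forall>X \<in> ?A. M \<subseteq> X \<longrightarrow> X = M" by (intro subset_Zorn_nonempty)
  then obtain M where M: "M \<in> ?A" "\<forall>X \<in> ?A. M \<subseteq> X \<longrightarrow> X = M" by (rule bexE)
  have "saturated L M"
    unfolding saturated_def
  proof (intro allI impI)
    fix \<C> assume "tableau_rule L M \<C>"
    \<comment> \<open>If every extension by some \<open>C\<close> were refutable, the rule would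
      make \<open>M\<close> refutable. Maximality then absorbs the surviving
      \<open>C\<close>.\<close>
    with M(1) obtain C where C: "C \<in> set \<C>" "\<not> refutable L CS (M \<union> C)"
      using refutable.rule[of L M \<C> CS] by blast
    with M(1) have "M \<union> C = M" by (intro M(2)[rule_format]) auto
    with C(1) show "\<exists>C \<in> set \<C>. C \<subseteq> M" by blast
  qed
  with M(1) show ?thesis using that[of M] refutable.closed[of CS M L] by blast
qed

section \<open>The model read off from a saturated open set\<close>

definition evidence :: "logic \<Rightarrow> ('v, 'c, 'p) fm set \<Rightarrow> ('v, 'c) tm \<Rightarrow> ('v, 'c, 'p) fm set" where
  "evidence L M t = {A \<in> Fm L. (\<^bold>\<not> t \<^bold>: A) \<notin> M}"

lemma const_chain_Fm:
  "A \<in> Fm L \<Longrightarrow> const_chain cs A \<in> Fm L"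
  by (induction cs) (auto simp: const_chain_def intro: Fm.intros Tm.intros)

lemma constant_specification_Fm:
  assumes "constant_specification L CS"
  shows "CS \<subseteq> Fm L"
  using assms const_chain_Fm
  unfolding constant_specification_def axiom_instance_def by fastforce

context
  fixes L :: logic and CS M :: "('v, 'c, 'p) fm set"
  assumes CS: "constant_specification L CS"
    and open_M: "\<not> closed_branch CS M"
    and saturated_M: "saturated L M"
begin

lemma saturatedD: "tableau_rule L M \<C> \<Longrightarrow> \<exists>C \<in> set \<C>. C \<subseteq> M"
  using saturated_M by (auto simp: saturated_def)

lemma saturated_rules:
  "(\<^bold>\<not> \<^bold>\<not> A) \<in> M \<Longrightarrow> A \<in> M"
  "(\<^bold>\<not> (A \<^bold>\<rightarrow> B)) \<in> M \<Longrightarrow> A \<in> M \<and> (\<^bold>\<not> B) \<in> M"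
  "(A \<^bold>\<rightarrow> B) \<in> M \<Longrightarrow> (\<^bold>\<not> A) \<in> M \<or> B \<in> M"
  "(\<^bold>\<not> (t \<^bold>+ s) \<^bold>: A) \<in> M \<Longrightarrow> (\<^bold>\<not> t \<^bold>: A) \<in> M \<and> (\<^bold>\<not> s \<^bold>: A) \<in> M"
  "(\<^bold>\<not> (s \<^bold>\<cdot> t) \<^bold>: B) \<in> M \<Longrightarrow> A \<in> Fm L \<Longrightarrow>
    (\<^bold>\<not> s \<^bold>: (A \<^bold>\<rightarrow> B)) \<in> M \<or> (\<^bold>\<not> t \<^bold>: A) \<in> M"
  "jT \<in> L \<Longrightarrow> t \<^bold>: A \<in> M \<Longrightarrow> A \<in> M"
  "jD \<in> L \<Longrightarrow> t \<in> Tm L \<Longrightarrow> (\<^bold>\<not> t \<^bold>: \<^bold>\<bottom>) \<in> M"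
  "j4 \<in> L \<Longrightarrow> (\<^bold>\<not> \<^bold>! t \<^bold>: t \<^bold>: A) \<in> M \<Longrightarrow> (\<^bold>\<not> t \<^bold>: A) \<in> M"
  "jB \<in> L \<Longrightarrow> (\<^bold>\<not> \<^bold>?\<^sub>B t \<^bold>: (\<^bold>\<not> t \<^bold>: A)) \<in> M \<Longrightarrow> A \<in> M"
  "j5 \<in> L \<Longrightarrow> (\<^bold>\<not> \<^bold>? t \<^bold>: (\<^bold>\<not> t \<^bold>: A)) \<in> M \<Longrightarrow> t \<^bold>: A \<in> M"
  subgoal using saturatedD[OF F_neg[of A M]] by simp
  subgoal using saturatedD[OF F_imp[of A B M]] by simp
  subgoal using saturatedD[OF T_imp[of A B M]] by simp
  subgoal using saturatedD[OF F_sum[of t s A M]] by simp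
  subgoal using saturatedD[OF F_app[of s t B M A]] by simp
  subgoal using saturatedD[OF T_just[of L t A M]] by simp
  subgoal using saturatedD[OF F_just_bot[of L t M]] by simp
  subgoal using saturatedD[OF F_bang[of L t A M]] by simp
  subgoal using saturatedD[OF F_barquery[of L t A M]] by simp
  subgoal using saturatedD[OF F_query[of L t A M]] by simp
  done

text \<open>Both signs are treated together because decomposing negations and implications switches
  between them. Forcing makes sense for any evidence function, so this can precede
  \<open>evidence_model\<close>, whose \<open>jB\<close> condition speaks of forcing.\<close>

lemma truth_lemma:
  assumes "A \<in> Fm L"
  shows "(A \<in> M \<longrightarrow> forces L (evidence L M) (\<lambda>p. Atom p \<in> M) A) \<and>
    ((\<^bold>\<not> A) \<in> M \<longrightarrow> \<not> forces L (evidence L M) (\<lambda>p. Atom p \<in> M) A)"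
  using assms
proof induction
  case (1 p)
  then show ?case using open_M by (auto simp: closed_branch_def)
next
  case 2
  then show ?case using open_M by (auto simp: closed_branch_def)
next
  case (3 A)
  then show ?case using saturated_rules(1)[of A] by simp
next
  case (4 A B)
  then show ?case using saturated_rules(2,3)[of A B] by auto
next
  case (5 t A)
  have "(\<^bold>\<not> t \<^bold>: A) \<notin> M" if "t \<^bold>: A \<in> M"
    using that open_M by (auto simp: closed_branch_def)
  \<comment> \<open>The negative half is the definition of \<open>evidence\<close>. In the positive
    half with \<open>jT\<close>, forcing also asks for \<open>A\<close> itself, which
    \<open>T_just\<close> puts into \<open>M\<close>.\<close>
  then show ?case using 5 saturated_rules(6)[of t A] by (auto simp: evidence_def)
qed

lemma evidence_model: "model L CS (evidence L M) (\<lambda>p. Atom p \<in> M)"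
  unfolding model_def
proof (intro conjI ballI allI impI)
  fix t :: "('v, 'c) tm"
  show "evidence L M t \<subseteq> Fm L" by (auto simp: evidence_def)
next
  fix s t :: "('v, 'c) tm" and A B :: "('v, 'c, 'p) fm"
  assume A: "(A \<^bold>\<rightarrow> B) \<in> evidence L M s \<and> A \<in> evidence L M t"
  \<comment> \<open>\<open>F_app\<close> may only introduce an \<open>A\<close> from the language,
    and the evidence for the product must again lie in \<open>Fm L\<close>.\<close>
  then have "A \<^bold>\<rightarrow> B \<in> Fm L" "A \<in> Fm L" by (auto simp: evidence_def)
  then have "B \<in> Fm L" by (auto elim: Fm.cases)
  with A show "B \<in> evidence L M (s \<^bold>\<cdot> t)"
    using saturated_rules(5)[of s t B A] by (auto simp: evidence_def)
next
  fix s t :: "('v, 'c) tm"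
  show "evidence L M s \<union> evidence L M t \<subseteq> evidence L M (s \<^bold>+ t)"
    using saturated_rules(4)[of s t] by (auto simp: evidence_def)
next
  fix c F assume c: "JConst c \<^bold>: F \<in> CS"
  then have "JConst c \<^bold>: F \<in> Fm L" using constant_specification_Fm[OF CS] by blast
  then have "F \<in> Fm L" by (auto elim: Fm.cases)
  with c open_M show "F \<in> evidence L M (JConst c)"
    by (auto simp: evidence_def closed_branch_def)
next
  fix t :: "('v, 'c) tm" assume "jD \<in> L" "t \<in> Tm L"
  then show "\<^bold>\<bottom> \<notin> evidence L M t"
    using saturated_rules(7)[of t] by (simp add: evidence_def)
next
  fix t :: "('v, 'c) tm" and A assume "j4 \<in> L" "t \<in> Tm L" "A \<in> evidence L M t"
  then show "t \<^bold>: A \<in> evidence L M (\<^bold>! t)"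
    using saturated_rules(8)[of t A] by (auto simp: evidence_def intro: Fm.intros)
next
  fix t :: "('v, 'c) tm" and A
  assume "jB \<in> L" "t \<in> Tm L" "A \<in> Fm L"
    and A: "\<not> forces L (evidence L M) (\<lambda>p. Atom p \<in> M) A"
  \<comment> \<open>The truth lemma turns failure of forcing into absence from \<open>M\<close>, to
    which \<open>F_barquery\<close> applies contrapositively.\<close>
  moreover from A have "A \<notin> M" using truth_lemma \<open>A \<in> Fm L\<close> by blast
  ultimately show "(\<^bold>\<not> t \<^bold>: A) \<in> evidence L M (\<^bold>?\<^sub>B t)"
    using saturated_rules(9)[of t A] by (auto simp: evidence_def intro: Fm.intros)
next
  fix t :: "('v, 'c) tm" and A
  assume "j5 \<in> L" "t \<in> Tm L" "A \<in> Fm L" "A \<notin> evidence L M t"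
  \<comment> \<open>For \<open>A\<close> in \<open>Fm L\<close>, missing evidence means that the
    negation of \<open>t : A\<close> is in \<open>M\<close>, so openness keeps \<open>t : A\<close>
    out.\<close>
  moreover from this have "t \<^bold>: A \<notin> M"
    using open_M by (auto simp: evidence_def closed_branch_def)
  ultimately show "(\<^bold>\<not> t \<^bold>: A) \<in> evidence L M (\<^bold>? t)"
    using saturated_rules(10)[of t A] by (auto simp: evidence_def intro: Fm.intros)
qed

end

theorem theorem3:
  fixes JL :: logic
    and CS :: "('v, 'c, 'p::countable) fm set"
    and A :: "('v, 'c, 'p) fm"
  assumes "constant_specification JL CS"
    and "A \<in> Fm JL"
    and "valid JL CS A"
  shows "\<exists>\<T>. tableau_proof JL CS A \<T>"
proof (rule ccontr)
  assume "\<not> ?thesis"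
  with assms(2) have "\<not> refutable JL CS {\<^bold>\<not> A}"
    using tableau_proof_if_refutable by blast
  then obtain M where M: "{\<^bold>\<not> A} \<subseteq> M" "\<not> closed_branch CS M" "saturated JL M"
    by (rule saturated_extension)
  have "forces JL (evidence JL M) (\<lambda>p. Atom p \<in> M) A"
    using assms(3) evidence_model[OF assms(1) M(2,3)] by (auto simp: valid_def)
  with truth_lemma[OF assms(1) M(2,3) assms(2)] M(1) show False by blast
qed

end
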